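(* Let $(P,\cdot,\{~,~\})$ be a Poisson algebra over a field of characteristic $0$. Then a linear map $r:P\to P$ is a modified Rota-Baxter operator on $P$ if and only if $Gr(r)=\{(r(x),x)\mid x\in P\}$ is a Poisson subalgebra of the modified semidirect product $(P\oplus P,\cdot_{\mathrm{mod}},\{~,~\}_{\mathrm{mod}})$.
   Context: A Poisson algebra is a vector space with a commutative associative product and a Lie bracket such that the bracket satisfies the Leibniz rule $\{x,yz\}=\{x,y\}z+y\{x,z\}$; a Poisson subalgebra is a subspace closed under both operations. The modified semidirect product is the Poisson algebra $P\oplus P$ with $(x,u)\cdot_{\mathrm{mod}}(y,v)=(x\cdot y+u\cdot v,\ x\cdot v+u\cdot y)$ and $\{(x,u),(y,v)\}_{\mathrm{mod}}=(\{x,y\}+\{u,v\},\ \{x,v\}+\{u,y\})$. A linear map $r:P\to P$ is a modified Rota-Baxter operator on $P$ if for all $x,y\in P$: $r(x)\cdot r(y)=r(r(x)\cdot y+x\cdot r(y))-x\cdot y$ and $\{r(x),r(y)\}=r(\{r(x),y\}+\{x,r(y)\})-\{x,y\}$. *)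

theory Defs
  imports "HOL-Analysis.Product_Vector"
begin

text \<open>The underlying vector space of a Poisson algebra is a whole type; its product is not
  assumed to have a unit.\<close>

locale poisson_algebra = vector_space smul
  for smul :: "'k::field \<Rightarrow> 'a::ab_group_add \<Rightarrow> 'a" +
  fixes mul :: "'a \<Rightarrow> 'a \<Rightarrow> 'a"
    and br :: "'a \<Rightarrow> 'a \<Rightarrow> 'a"
  assumes mul_linear_left: "Vector_Spaces.linear smul smul (\<lambda>x. mul x y)"
    and mul_linear_right: "Vector_Spaces.linear smul smul (\<lambda>y. mul x y)"
    and mul_commute: "mul x y = mul y x"
    and mul_assoc: "mul (mul x y) z = mul x (mul y z)"
    and br_linear_left: "Vector_Spaces.linear smul smul (\<lambda>x. br x y)"
    and br_linear_right: "Vector_Spaces.linear smul smul (\<lambda>y. br x y)"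
    and br_self: "br x x = 0"
    and jacobi: "br x (br y z) + br y (br z x) + br z (br x y) = 0"
    and leibniz: "br x (mul y z) = mul (br x y) z + mul y (br x z)"

definition poisson_subalgebra ::
    "('k::field \<Rightarrow> 'a::ab_group_add \<Rightarrow> 'a) \<Rightarrow> ('a \<Rightarrow> 'a \<Rightarrow> 'a) \<Rightarrow> ('a \<Rightarrow> 'a \<Rightarrow> 'a) \<Rightarrow> 'a set \<Rightarrow> bool"
  where "poisson_subalgebra smul mul br S \<longleftrightarrow>
    module.subspace smul S \<and>
    (\<forall>x\<in>S. \<forall>y\<in>S. mul x y \<in> S) \<and>
    (\<forall>x\<in>S. \<forall>y\<in>S. br x y \<in> S)"

definition modified_rota_baxter ::
    "('k::field \<Rightarrow> 'a::ab_group_add \<Rightarrow> 'a) \<Rightarrow> ('a \<Rightarrow> 'a \<Rightarrow> 'a) \<Rightarrow> ('a \<Rightarrow> 'a \<Rightarrow> 'a) \<Rightarrow> ('a \<Rightarrow> 'a) \<Rightarrow> bool"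
  where "modified_rota_baxter smul mul br r \<longleftrightarrow>
    Vector_Spaces.linear smul smul r \<and>
    (\<forall>x y. mul (r x) (r y) = r (mul (r x) y + mul x (r y)) - mul x y) \<and>
    (\<forall>x y. br (r x) (r y) = r (br (r x) y + br x (r y)) - br x y)"

definition mod_mul :: "('a::plus \<Rightarrow> 'a \<Rightarrow> 'a) \<Rightarrow> 'a \<times> 'a \<Rightarrow> 'a \<times> 'a \<Rightarrow> 'a \<times> 'a"
  where "mod_mul mul = (\<lambda>(x, u) (y, v). (mul x y + mul u v, mul x v + mul u y))"

definition mod_br :: "('a::plus \<Rightarrow> 'a \<Rightarrow> 'a) \<Rightarrow> 'a \<times> 'a \<Rightarrow> 'a \<times> 'a \<Rightarrow> 'a \<times> 'a"
  where "mod_br br = (\<lambda>(x, u) (y, v). (br x y + br u v, br x v + br u y))"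

definition Gr :: "('a \<Rightarrow> 'a) \<Rightarrow> ('a \<times> 'a) set"
  where "Gr r = {(r x, x) | x. True}"

lemma (in poisson_algebra) modified_semidirect_product:
  "poisson_algebra (module_prod.scale smul smul) (mod_mul mul) (mod_br br)"
proof -
  interpret P: vector_space_prod smul smul ..
  note bilinear = mul_linear_left mul_linear_right br_linear_left br_linear_right
  note additive = bilinear[unfolded Vector_Spaces.linear_iff, THEN conjunct2, THEN conjunct2,
      THEN conjunct1, rule_format]
  note homogeneous = bilinear[unfolded Vector_Spaces.linear_iff, THEN conjunct2, THEN conjunct2,
      THEN conjunct2, rule_format]
  have skew: "br x y + br y x = 0" for x y
    using br_self[of "x + y"] br_self[of x] br_self[of y] by (simp add: additive add.commute)
  have mul_left_commute: "mul x (mul y z) = mul y (mul x z)" for x y z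
    using mul_assoc mul_commute by metis
  show ?thesis
  proof unfold_locales
    fix p :: "'a \<times> 'a"
    show "mod_br br p p = 0"
      by (cases p) (simp add: mod_br_def br_self skew zero_prod_def)
  next
    fix p q s :: "'a \<times> 'a"
    obtain x u y v z w where [simp]: "p = (x, u)" "q = (y, v)" "s = (z, w)"
      by (cases p, cases q, cases s)
    have sum_fst: "(a1 + a2 + (a3 + a4)) + (b1 + b2 + (b3 + b4)) + (c1 + c2 + (c3 + c4)) = 0"
      if "a1 + b1 + c1 = 0" "a2 + b4 + c3 = 0" "a3 + b2 + c4 = 0" "a4 + b3 + c2 = 0"
      for a1 a2 a3 a4 b1 b2 b3 b4 c1 c2 c3 c4 :: 'a
    proof -
      have "(a1 + a2 + (a3 + a4)) + (b1 + b2 + (b3 + b4)) + (c1 + c2 + (c3 + c4))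
          = (a1 + b1 + c1) + (a2 + b4 + c3) + (a3 + b2 + c4) + (a4 + b3 + c2)"
        by (simp only: ac_simps)
      then show ?thesis using that by simp
    qed
    have sum_snd: "(a1 + a2 + (a3 + a4)) + (b1 + b2 + (b3 + b4)) + (c1 + c2 + (c3 + c4)) = 0"
      if "a1 + b2 + c3 = 0" "a2 + b3 + c1 = 0" "a3 + b1 + c2 = 0" "a4 + b4 + c4 = 0"
      for a1 a2 a3 a4 b1 b2 b3 b4 c1 c2 c3 c4 :: 'a
    proof -
      have "(a1 + a2 + (a3 + a4)) + (b1 + b2 + (b3 + b4)) + (c1 + c2 + (c3 + c4))
          = (a1 + b2 + c3) + (a2 + b3 + c1) + (a3 + b1 + c2) + (a4 + b4 + c4)"
        by (simp only: ac_simps)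
      then show ?thesis using that by simp
    qed
    show "mod_br br p (mod_br br q s) + mod_br br q (mod_br br s p)
        + mod_br br s (mod_br br p q) = 0"
      by (simp add: mod_br_def additive zero_prod_def)
        (intro conjI; (rule sum_fst; rule jacobi | rule sum_snd; rule jacobi))
  qed (auto simp: mod_mul_def mod_br_def Vector_Spaces.linear_iff P.scale_prod additive homogeneous
      P.p.vector_space_axioms mul_assoc leibniz scale_right_distrib
      mul_commute mul_left_commute ac_simps)
qed

end

theory Submission
  imports Defs
begin

text \<open>A pair \<open>(a, b)\<close> lies on the graph exactly when \<open>a = r b\<close>. The
  modified product of \<open>(r x, x)\<close> and \<open>(r y, y)\<close> is
  \<open>(r x * r y + x * y, r x * y + x * r y)\<close>, so its membership in \<open>Gr r\<close> is
  the modified Rota-Baxter identity with \<open>x * y\<close> moved to the other side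
  (\<open>Gr_closed_mod_mul_iff\<close>). The bracket behaves the same way, and linearity of
  \<open>r\<close> makes the graph a subspace (\<open>subspace_Gr\<close>).\<close>

lemma Pair_in_Gr_iff: "(a, b) \<in> Gr r \<longleftrightarrow> a = r b"
  by (auto simp: Gr_def)

lemma ball_Gr: "(\<forall>p\<in>Gr r. Q p) \<longleftrightarrow> (\<forall>x. Q (r x, x))"
  by (auto simp: Gr_def)

lemma subspace_Gr:
  fixes smul :: "'k::field \<Rightarrow> 'a::ab_group_add \<Rightarrow> 'a"
  assumes "Vector_Spaces.linear smul smul r"
  shows "module.subspace (module_prod.scale smul smul) (Gr r)"
proof -
  interpret Vector_Spaces.linear smul smul r by fact
  interpret P: vector_space_prod smul smul ..
  show ?thesis
    by (auto simp: P.p.subspace_def ball_Gr Pair_in_Gr_iff zero_prod_def P.scale_prod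
        zero add scale)
qed

text \<open>The operation \<open>f\<close> is arbitrary so that one equivalence serves both the
  product and the bracket.\<close>

lemma Gr_closed_mod_mul_iff:
  fixes f :: "'a::ab_group_add \<Rightarrow> 'a \<Rightarrow> 'a"
  shows "(\<forall>p\<in>Gr r. \<forall>q\<in>Gr r. mod_mul f p q \<in> Gr r) \<longleftrightarrow>
    (\<forall>x y. f (r x) (r y) = r (f (r x) y + f x (r y)) - f x y)"
  by (simp add: ball_Gr mod_mul_def Pair_in_Gr_iff eq_diff_eq)

text \<open>Carries the closure criterion for \<open>mod_mul\<close> over to the bracket.\<close>

lemma mod_br_eq_mod_mul: "mod_br = mod_mul"
  by (simp add: fun_eq_iff mod_br_def mod_mul_def)

theorem proposition5p24:
  fixes smul :: "'k::field_char_0 \<Rightarrow> 'a::ab_group_add \<Rightarrow> 'a"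
    and mul br :: "'a \<Rightarrow> 'a \<Rightarrow> 'a"
    and r :: "'a \<Rightarrow> 'a"
  assumes "poisson_algebra smul mul br"
    and "Vector_Spaces.linear smul smul r"
  shows "modified_rota_baxter smul mul br r \<longleftrightarrow>
    poisson_subalgebra (module_prod.scale smul smul) (mod_mul mul) (mod_br br) (Gr r)"
  using assms(2) subspace_Gr[OF assms(2)]
  by (simp add: modified_rota_baxter_def poisson_subalgebra_def mod_br_eq_mod_mul
      Gr_closed_mod_mul_iff)

end
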